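(* Let $G$ be a finite group and let $p$ be a prime. Then $$\frac{|\mathbf{C}_G(x)_p|}{|G_p|} \leq \frac{1}{p}$$ for every $p$-element $x \in G \setminus \mathbf{O}_p(G)$.
   Context: A $p$-element is an element of order $p^m$ for some $m \geq 0$. For a finite group $H$, $H_p$ denotes the set of $p$-elements of $H$ (including the identity). $\mathbf{C}_G(x)$ is the centralizer of $x$ in $G$, so $\mathbf{C}_G(x)_p$ is the set of $p$-elements of $G$ commuting with $x$. $\mathbf{O}_p(G)$ is the largest normal $p$-subgroup of $G$. *)

theory Defs
  imports "HOL-Algebra.Algebra"
begin

definition p_elements :: "nat \<Rightarrow> ('a, 'b) monoid_scheme \<Rightarrow> 'a set" where
  "p_elements p H = {x \<in> carrier H. \<exists>m. group.ord H x = p ^ m}"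

definition centralizer :: "('a, 'b) monoid_scheme \<Rightarrow> 'a \<Rightarrow> 'a set" where
  "centralizer G x = {g \<in> carrier G. g \<otimes>\<^bsub>G\<^esub> x = x \<otimes>\<^bsub>G\<^esub> g}"

abbreviation centralizer_group :: "('a, 'b) monoid_scheme \<Rightarrow> 'a \<Rightarrow> ('a, 'b) monoid_scheme" where
  "centralizer_group G x \<equiv> G\<lparr>carrier := centralizer G x\<rparr>"

definition normal_p_subgroup :: "nat \<Rightarrow> ('a, 'b) monoid_scheme \<Rightarrow> 'a set \<Rightarrow> bool" where
  "normal_p_subgroup p G P \<longleftrightarrow> P \<lhd> G \<and> (\<exists>k. card P = p ^ k)"

text \<open>
  The greatest element with respect to inclusion. For finite \<open>G\<close> and prime \<open>p\<close> it exists; see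
  \<open>normal_p_subgroup_p_core\<close> and \<open>p_core_greatest\<close> below.
\<close>

definition p_core :: "nat \<Rightarrow> ('a, 'b) monoid_scheme \<Rightarrow> 'a set" where
  "p_core p G = (GREATEST P. normal_p_subgroup p G P)"

context group
begin

lemma subgroup_centralizer:
  assumes x: "x \<in> carrier G"
  shows "subgroup (centralizer G x) G"
proof (rule subgroupI)
  show "centralizer G x \<noteq> {}"
    using x one_closed by (force simp: centralizer_def)
next
  fix a assume a: "a \<in> centralizer G x"
  then have ac: "a \<in> carrier G" and ax: "a \<otimes> x = x \<otimes> a"
    by (auto simp: centralizer_def)
  have "inv a \<otimes> x = inv a \<otimes> (x \<otimes> a) \<otimes> inv a"
    using ac x by (simp add: m_assoc)
  also have "\<dots> = inv a \<otimes> (a \<otimes> x) \<otimes> inv a"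
    by (simp add: ax)
  also have "\<dots> = x \<otimes> inv a"
    using ac x by (simp flip: m_assoc)
  finally show "inv a \<in> centralizer G x"
    using ac by (simp add: centralizer_def)
next
  fix a b assume "a \<in> centralizer G x" "b \<in> centralizer G x"
  then have ac: "a \<in> carrier G" "b \<in> carrier G"
    and ax: "a \<otimes> x = x \<otimes> a" and bx: "b \<otimes> x = x \<otimes> b"
    by (auto simp: centralizer_def)
  have "a \<otimes> b \<otimes> x = a \<otimes> x \<otimes> b"
    using ac x by (simp add: m_assoc bx)
  also have "\<dots> = x \<otimes> (a \<otimes> b)"
    using ac x by (simp add: ax m_assoc)
  finally show "a \<otimes> b \<in> centralizer G x"
    using ac by (simp add: centralizer_def)
qed (auto simp: centralizer_def)

lemma p_elements_centralizer:
  assumes x: "x \<in> carrier G"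
  shows "p_elements p (centralizer_group G x) = {y \<in> p_elements p G. y \<otimes> x = x \<otimes> y}"
proof -
  have "group (centralizer_group G x)"
    using subgroup_centralizer[OF x] subgroup_imp_group by blast
  then have "group.ord (centralizer_group G x) y = ord y" for y
    by (simp add: ord_def group.ord_def flip: nat_pow_consistent)
  then show ?thesis
    by (auto simp: p_elements_def centralizer_def)
qed

lemma card_normal_set_mult:
  assumes fin: "finite (carrier G)" and H: "H \<lhd> G" and S: "subgroup S G"
  shows "card (H <#> S) * card (H \<inter> S) = card H * card S"
proof -
  interpret second_isomorphism_grp H G S
    using H S by (simp add: second_isomorphism_grp_def second_isomorphism_grp_axioms_def)
  let ?HS = "G\<lparr>carrier := H <#> S\<rparr>" and ?S = "G\<lparr>carrier := S\<rparr>"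
  have fHS: "finite (H <#> S)" and fS: "finite S"
    using fin normal_set_mult_subgroup S finite_subset subgroup.subset by metis+
  have gHS: "group ?HS" and gS: "group ?S"
    using normal_set_mult_subgroup S subgroup_imp_group by blast+
  have "subgroup H ?HS"
    using H H_contained_in_set_mult normal_set_mult_subgroup
    by (simp add: normal_imp_subgroup subgroup_incl)
  from group.lagrange[OF gHS this]
  have 1: "card (rcosets\<^bsub>?HS\<^esub> H) * card H = card (H <#> S)"
    by (simp add: order_def)
  have "subgroup (H \<inter> S) ?S"
    using normal_imp_subgroup[OF normal_subgrp_intersection_normal] by (simp add: Int_commute)
  from group.lagrange[OF gS this]
  have 2: "card (rcosets\<^bsub>?S\<^esub> (H \<inter> S)) * card (H \<inter> S) = card S"
    by (simp add: order_def)
  have "bij_betw (\<lambda>C. the_elem ((\<lambda>g. H #> g) ` C))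
      (carrier (?S Mod (H \<inter> S))) (carrier (?HS Mod H))"
    using normal_intersection_quotient_isom by (simp add: iso_def)
  then have 3: "card (rcosets\<^bsub>?S\<^esub> (H \<inter> S)) = card (rcosets\<^bsub>?HS\<^esub> H)"
    by (simp add: bij_betw_same_card FactGroup_def)
  show ?thesis
    using 1 2 3 by (metis mult.assoc mult.commute)
qed

lemma normal_p_subgroup_set_mult:
  assumes fin: "finite (carrier G)" and p: "Factorial_Ring.prime p"
    and P: "normal_p_subgroup p G P" and Q: "normal_p_subgroup p G Q"
  shows "normal_p_subgroup p G (P <#> Q)"
proof -
  from P Q obtain i j where card: "card P = p ^ i" "card Q = p ^ j"
    and n: "P \<lhd> G" "Q \<lhd> G"
    by (auto simp: normal_p_subgroup_def)
  have "card (P <#> Q) dvd p ^ (i + j)"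
    using card_normal_set_mult[OF fin n(1) normal_imp_subgroup[OF n(2)]] card
    by (metis dvd_triv_left power_add)
  then have "\<exists>k. card (P <#> Q) = p ^ k"
    using divides_primepow_nat[OF p] by blast
  then show ?thesis
    using normal_subgroup_set_mult_closed[OF n] by (simp add: normal_p_subgroup_def)
qed

lemma ex_greatest_normal_p_subgroup:
  assumes fin: "finite (carrier G)" and p: "Factorial_Ring.prime p"
  shows "\<exists>P. normal_p_subgroup p G P \<and> (\<forall>Q. normal_p_subgroup p G Q \<longrightarrow> Q \<subseteq> P)"
proof -
  have sub: "P \<subseteq> carrier G" if "normal_p_subgroup p G P" for P
    using that by (simp add: normal_p_subgroup_def normal_imp_subgroup subgroup.subset)
  have "finite {P. normal_p_subgroup p G P}"
    by (rule finite_subset[of _ "Pow (carrier G)"]) (use sub fin in auto)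
  moreover have "normal_p_subgroup p G {\<one>}"
    by (auto simp: normal_p_subgroup_def one_is_normal intro: exI[of _ 0])
  ultimately obtain P where P: "normal_p_subgroup p G P"
    and max: "\<And>Q. normal_p_subgroup p G Q \<Longrightarrow> P \<subseteq> Q \<Longrightarrow> Q = P"
    using finite_has_maximal[of "{P. normal_p_subgroup p G P}"] by auto
  have "Q \<subseteq> P" if Q: "normal_p_subgroup p G Q" for Q
  proof -
    interpret second_isomorphism_grp P G Q
      using P Q by (simp add: normal_p_subgroup_def normal_imp_subgroup
          second_isomorphism_grp_def second_isomorphism_grp_axioms_def)
    show ?thesis
      using max[OF normal_p_subgroup_set_mult[OF fin p P Q] H_contained_in_set_mult]
        S_contained_in_set_mult by simp
  qed
  with P show ?thesis by blast
qed

lemma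
  assumes "finite (carrier G)" and "Factorial_Ring.prime p"
  shows normal_p_subgroup_p_core: "normal_p_subgroup p G (p_core p G)"
    and p_core_greatest: "normal_p_subgroup p G Q \<Longrightarrow> Q \<subseteq> p_core p G"
proof -
  obtain P where P: "normal_p_subgroup p G P" "\<And>Q. normal_p_subgroup p G Q \<Longrightarrow> Q \<subseteq> P"
    using ex_greatest_normal_p_subgroup[OF assms] by blast
  then have "p_core p G = P"
    unfolding p_core_def by (intro Greatest_equality)
  with P show "normal_p_subgroup p G (p_core p G)"
    and "normal_p_subgroup p G Q \<Longrightarrow> Q \<subseteq> p_core p G"
    by auto
qed

end

end

theory Submission
  imports Defs
begin

text \<open>
  Choose a subgroup \<open>U\<close> of minimal order containing a conjugate of \<open>x\<close> outside \<open>O\<^sub>p(U)\<close>, and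
  let \<open>K\<close> be the set of these conjugates. By minimality every proper subgroup \<open>V\<close> of \<open>U\<close> satisfies
  \<open>K \<inter> V \<subseteq> O\<^sub>p(V)\<close>. As in Wielandt's zipper lemma, normalizers growing in \<open>p\<close>-groups
  then force the maximal sets of the form \<open>Q \<inter> K\<close>, with \<open>Q\<close> a \<open>p\<close>-subgroup of \<open>U\<close>, to be pairwise
  disjoint blocks, and two elements of different blocks generate \<open>U\<close>. An element of \<open>K\<close> permutes the
  blocks and fixes only its own one; its orbit on another block has at least \<open>p\<close> members, so there
  are conjugates \<open>x\<^sub>0, \<dots>, x\<^sub>p\<close> of \<open>x\<close>, any two of which generate \<open>U\<close>.

  Let \<open>c = |C\<^sub>G(x)\<^sub>p|\<close>. The \<open>p + 1\<close> sets \<open>C\<^sub>G(x\<^sub>i)\<^sub>p\<close> have size \<open>c\<close> and pairwise meet exactly in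
  \<open>I = C\<^sub>G(U)\<^sub>p\<close>. No \<open>x\<^sub>0\<^sup>i\<close> with \<open>0 < i < p\<close> centralizes \<open>U\<close>, so the sets \<open>I x\<^sub>0\<^sup>i\<close>
  with \<open>i < p\<close> are disjoint in \<open>C\<^sub>G(x\<^sub>0)\<^sub>p\<close>, whence \<open>p |I| \<le> c\<close> and
  \<open>|G\<^sub>p| \<ge> (p + 1) c - p |I| \<ge> p c\<close>.
\<close>

section \<open>Growth of normalizers in \<open>p\<close>-groups\<close>

text \<open>The restriction to \<open>E\<close> is there because \<open>Bij E\<close> contains only
  extensional functions.\<close>

lemma (in group) group_actionI:
  assumes "\<And>g e. g \<in> carrier G \<Longrightarrow> e \<in> E \<Longrightarrow> act g e \<in> E"
    and "\<And>e. e \<in> E \<Longrightarrow> act \<one> e = e"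
    and "\<And>g h e. g \<in> carrier G \<Longrightarrow> h \<in> carrier G \<Longrightarrow> e \<in> E \<Longrightarrow> act (g \<otimes> h) e = act g (act h e)"
  shows "group_action G E (\<lambda>g. restrict (act g) E)"
proof -
  have bij: "restrict (act g) E \<in> Bij E" if g: "g \<in> carrier G" for g
  proof -
    have "bij_betw (act g) E E"
      by (rule bij_betwI[where g = "act (inv g)"])
        (use g assms in \<open>auto simp flip: assms(3)\<close>)
    then show ?thesis
      by (simp add: Bij_def bij_betw_def inj_on_def)
  qed
  show ?thesis
    unfolding group_action_def group_hom_def group_hom_axioms_def
    using is_group group_BijGroup assms
    by (auto simp: hom_def BijGroup_def bij compose_def fun_eq_iff)
qed

text \<open>By the orbit-stabilizer theorem every orbit has size a power of \<open>p\<close>, and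
  size 1 exactly on fixed points; so all other orbits contribute multiples of \<open>p\<close> to
  \<open>card E\<close>.\<close>

lemma (in group_action) p_group_fixed_points:
  assumes p: "Factorial_Ring.prime p" and G: "order G = p ^ k" and E: "finite E"
  shows "p dvd card E \<longleftrightarrow> p dvd card {e \<in> E. \<forall>g \<in> carrier G. \<phi> g e = e}"
proof -
  interpret group G
    using group_hom group_hom.axioms(1) by auto
  define F where "F = {e \<in> E. \<forall>g \<in> carrier G. \<phi> g e = e}"
  have orb: "orbit G \<phi> e \<subseteq> E" if "e \<in> E" for e
    using that element_image by (auto simp: orbit_def)
  have fixed: "orbit G \<phi> e = {e}" if "e \<in> F" for e
    using that one_closed orbit_refl by (auto simp: orbit_def F_def)
  have moved: "p dvd card (orbit G \<phi> e)" if e: "e \<in> E - F" for e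
  proof (rule ccontr)
    assume not: "\<not> p dvd card (orbit G \<phi> e)"
    have "card (orbit G \<phi> e) dvd p ^ k"
      using orbit_stabilizer_theorem[of e] e G by (metis DiffD1 dvd_triv_left)
    then have "card (orbit G \<phi> e) = 1"
      using not divides_primepow_nat[OF p] by (metis dvd_power power_0 gr0I)
    then have "orbit G \<phi> e = {e}"
      using orbit_refl e by (metis DiffD1 card_1_singletonE singletonD)
    then show False
      using e by (auto simp: F_def orbit_def)
  qed
  have "card E = (\<Sum>A \<in> orbits G E \<phi>. card A)"
    unfolding card_eq_sum by (rule disjoint_sum[OF E, symmetric])
  also have "\<dots> = (\<Sum>A \<in> orbit G \<phi> ` F. card A) + (\<Sum>A \<in> orbits G E \<phi> - orbit G \<phi> ` F. card A)"
  proof (subst add.commute, rule sum.subset_diff)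
    show "orbit G \<phi> ` F \<subseteq> orbits G E \<phi>"
      by (auto simp: orbits_def F_def)
    show "finite (orbits G E \<phi>)"
      by (rule finite_subset[of _ "Pow E"]) (use E orb in \<open>auto simp: orbits_def\<close>)
  qed
  also have "(\<Sum>A \<in> orbit G \<phi> ` F. card A) = (\<Sum>e \<in> F. card {e})"
    by (subst sum.reindex) (auto simp: fixed inj_on_def)
  finally have "card E = card F + (\<Sum>A \<in> orbits G E \<phi> - orbit G \<phi> ` F. card A)"
    by simp
  moreover have "p dvd (\<Sum>A \<in> orbits G E \<phi> - orbit G \<phi> ` F. card A)"
    by (rule dvd_sum) (use moved in \<open>auto simp: orbits_def\<close>)
  ultimately show ?thesis
    unfolding F_def[symmetric] by (simp add: dvd_add_left_iff)
qed

text \<open>Let \<open>S\<close> act on its right cosets by right multiplication. Their number is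
  divisible by \<open>p\<close>, hence so is the number of fixed ones. \<open>S\<close> itself is
  fixed, so there is another fixed coset \<open>S #> g\<close>, and being fixed means that
  \<open>g\<close> normalizes \<open>S\<close>.\<close>

lemma (in group) normalizer_grows:
  assumes p: "Factorial_Ring.prime p" and G: "order G = p ^ k"
    and S: "subgroup S G" "S \<noteq> carrier G"
  shows "\<exists>g \<in> carrier G - S. \<forall>s \<in> S. g \<otimes> s \<otimes> inv g \<in> S"
proof -
  have fin: "finite (carrier G)"
    using G p by (metis order_gt_0_iff_finite prime_gt_0_nat zero_less_power)
  let ?S = "G\<lparr>carrier := S\<rparr>"
  interpret S: group ?S
    using S subgroup_imp_group by blast
  have Sc: "S \<subseteq> carrier G"
    using S subgroup.subset by blast
  have rc: "C \<subseteq> carrier G" if "C \<in> rcosets S" for C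
    using that Sc rcosets_subset_PowG S(1) by blast
  \<comment> \<open>The inverse turns right multiplication into a left action.\<close>
  interpret group_action ?S "rcosets S" "\<lambda>s. restrict (\<lambda>C. C #> inv s) (rcosets S)"
  proof (rule S.group_actionI)
    fix s C assume s: "s \<in> carrier ?S" and C: "C \<in> rcosets S"
    then obtain g where g: "g \<in> carrier G" "C = S #> g"
      by (auto simp: RCOSETS_def)
    have "C #> inv s = S #> (g \<otimes> inv s)"
      using g s Sc by (simp add: coset_mult_assoc subset_iff)
    then show "C #> inv s \<in> rcosets S"
      using g s Sc by (auto intro!: rcosetsI)
  next
    fix C assume "C \<in> rcosets S"
    then show "C #> inv \<one>\<^bsub>?S\<^esub> = C"
      using rc by simp
  next
    fix s t C assume "s \<in> carrier ?S" "t \<in> carrier ?S" "C \<in> rcosets S"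
    then show "C #> inv (s \<otimes>\<^bsub>?S\<^esub> t) = C #> inv t #> inv s"
      using rc Sc by (simp add: inv_mult_group coset_mult_assoc subset_iff)
  qed
  define F where "F = {C \<in> rcosets S. \<forall>s \<in> S. C #> inv s = C}"
  have finR: "finite (rcosets S)"
    using fin rc by (metis finite_Pow_iff finite_subset rcosets_subset_PowG S(1))
  have "card S dvd p ^ k" "card (rcosets S) dvd p ^ k"
    using lagrange[OF S(1)] G by (metis dvd_triv_left dvd_triv_right)+
  then obtain a b where a: "card S = p ^ a" and b: "card (rcosets S) = p ^ b"
    using divides_primepow_nat[OF p] by metis
  have "b \<noteq> 0"
  proof
    assume "b = 0"
    then have "card S = card (carrier G)"
      using lagrange[OF S(1)] b by (simp add: order_def)
    then show False
      using S(2) Sc fin card_subset_eq by blast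
  qed
  then have "p dvd card (rcosets S)"
    using b by simp
  moreover have "p dvd card (rcosets S) \<longleftrightarrow> p dvd card F"
    using p_group_fixed_points[OF p _ finR] a
    by (simp add: F_def order_def cong: conj_cong)
  ultimately have "p dvd card F"
    by blast
  moreover have SF: "S \<in> F"
  proof -
    have "S #> \<one> \<in> rcosets S"
      using Sc by (intro rcosetsI) auto
    moreover have "S #> inv s = S" if "s \<in> S" for s
      using coset_join2[OF _ S(1), of "inv s"] subgroup.m_inv_closed[OF S(1) that] Sc by blast
    ultimately show ?thesis
      using Sc by (auto simp: F_def)
  qed
  ultimately have "F \<noteq> {S}"
    using p by auto
  with SF obtain C where C: "C \<in> F" "C \<noteq> S"
    by blast
  then obtain g where g: "g \<in> carrier G" "C = S #> g"
    by (auto simp: F_def RCOSETS_def)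
  have "g \<notin> S"
    using C g coset_join2 S(1) by blast
  moreover have "g \<otimes> s \<otimes> inv g \<in> S" if s: "s \<in> S" for s
  proof -
    \<comment> \<open>The fixed-point condition is taken at \<open>inv s\<close>, so that the
      inverse in the action cancels.\<close>
    have "C #> inv (inv s) = C"
      using C subgroup.m_inv_closed[OF S(1) s] by (simp add: F_def)
    then have "S #> (g \<otimes> s) = S #> g"
      using g s Sc by (simp add: coset_mult_assoc subset_iff)
    then have "g \<otimes> s \<in> S #> g"
      using g s Sc S(1) by (metis m_closed rcos_self subsetD)
    then obtain t where t: "t \<in> S" "g \<otimes> s = t \<otimes> g"
      by (auto simp: r_coset_def)
    then have "g \<otimes> s \<otimes> inv g = t"
      using g Sc by (simp add: m_assoc subset_iff)
    then show ?thesis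
      using t by simp
  qed
  ultimately show ?thesis
    using g by blast
qed

section \<open>Conjugation and \<open>p\<close>-subgroups\<close>

context group
begin

definition conjg :: "'a \<Rightarrow> 'a \<Rightarrow> 'a"
  where "conjg g y = g \<otimes> y \<otimes> inv g"

definition p_subgroup :: "nat \<Rightarrow> 'a set \<Rightarrow> bool"
  where "p_subgroup p H \<longleftrightarrow> subgroup H G \<and> (\<exists>k. card H = p ^ k)"

lemma conjg_closed [simp]: "g \<in> carrier G \<Longrightarrow> y \<in> carrier G \<Longrightarrow> conjg g y \<in> carrier G"
  by (simp add: conjg_def)

lemma conjg_one [simp]: "y \<in> carrier G \<Longrightarrow> conjg \<one> y = y"
  by (simp add: conjg_def)

lemma conjg_mult:
  "g \<in> carrier G \<Longrightarrow> h \<in> carrier G \<Longrightarrow> y \<in> carrier G \<Longrightarrow> conjg (g \<otimes> h) y = conjg g (conjg h y)"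
  by (simp add: conjg_def m_assoc inv_mult_group)

lemma conjg_inv [simp]:
  assumes "g \<in> carrier G" "y \<in> carrier G"
  shows "conjg (inv g) (conjg g y) = y" "conjg g (conjg (inv g) y) = y"
  using assms conjg_mult[of "inv g" g y] conjg_mult[of g "inv g" y] by simp_all

lemma conjg_eq_iff [simp]:
  assumes "g \<in> carrier G" "y \<in> carrier G" "z \<in> carrier G"
  shows "conjg g y = conjg g z \<longleftrightarrow> y = z"
proof
  assume "conjg g y = conjg g z"
  then have "conjg (inv g) (conjg g y) = conjg (inv g) (conjg g z)"
    by simp
  then show "y = z"
    using assms by simp
qed simp

lemma conjg_hom: "g \<in> carrier G \<Longrightarrow> group_hom G G (conjg g)"
proof (unfold_locales, rule homI)
  fix a b assume g: "g \<in> carrier G" and ab: "a \<in> carrier G" "b \<in> carrier G"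
  have "inv g \<otimes> (g \<otimes> (b \<otimes> inv g)) = b \<otimes> inv g"
    using g ab by (simp flip: m_assoc)
  then show "conjg g (a \<otimes> b) = conjg g a \<otimes> conjg g b"
    using g ab by (simp add: conjg_def m_assoc)
qed auto

lemma conjg_mult_distrib:
  "g \<in> carrier G \<Longrightarrow> a \<in> carrier G \<Longrightarrow> b \<in> carrier G \<Longrightarrow> conjg g (a \<otimes> b) = conjg g a \<otimes> conjg g b"
  using group_hom.hom_mult[OF conjg_hom] .

lemma inj_on_conjg: "g \<in> carrier G \<Longrightarrow> A \<subseteq> carrier G \<Longrightarrow> inj_on (conjg g) A"
  by (auto simp: inj_on_def subset_iff)

lemma ord_conjg:
  assumes "g \<in> carrier G" "y \<in> carrier G"
  shows "ord (conjg g y) = ord y"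
proof -
  interpret group_hom G G "conjg g"
    using assms conjg_hom by blast
  have "conjg g y [^] n = \<one> \<longleftrightarrow> y [^] n = \<one>" for n :: nat
    using assms conjg_eq_iff[of g "y [^] n" \<one>] hom_nat_pow[of y n] by simp
  then show ?thesis
    using assms by (simp add: ord_def)
qed

lemma p_elements_conjg:
  assumes "g \<in> carrier G" "y \<in> p_elements p G"
  shows "conjg g y \<in> p_elements p G"
  using assms by (simp add: p_elements_def ord_conjg)

lemma conjg_image_conjg:
  "g \<in> carrier G \<Longrightarrow> h \<in> carrier G \<Longrightarrow> A \<subseteq> carrier G \<Longrightarrow> conjg g ` conjg h ` A = conjg (g \<otimes> h) ` A"
  unfolding image_image by (rule image_cong) (auto simp: conjg_mult subset_iff)

lemma conjg_image_one [simp]: "A \<subseteq> carrier G \<Longrightarrow> conjg \<one> ` A = A"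
  by (rule trans[OF image_cong[where g = id]]) (auto simp: subset_iff)

text \<open>Conjugation is injective, so on a finite set inclusion already gives equality.\<close>

lemma conjg_image_eq:
  assumes "g \<in> carrier G" "A \<subseteq> carrier G" "finite A" "conjg g ` A \<subseteq> A"
  shows "conjg g ` A = A"
  using assms by (simp add: card_image card_subset_eq inj_on_conjg)

lemma p_subgroup_subset:
  assumes p: "Factorial_Ring.prime p" and Q: "p_subgroup p Q" and R: "subgroup R G" "R \<subseteq> Q"
  shows "p_subgroup p R"
proof -
  obtain k where k: "subgroup Q G" "card Q = p ^ k"
    using Q by (auto simp: p_subgroup_def)
  have "subgroup R (G\<lparr>carrier := Q\<rparr>)"
    using R k by (simp add: subgroup_incl)
  from group.lagrange[OF subgroup_imp_group[OF k(1)] this]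
  have "card R dvd p ^ k"
    using k by (simp add: order_def) (metis dvd_triv_right)
  then show ?thesis
    using divides_primepow_nat[OF p] R by (auto simp: p_subgroup_def)
qed

lemma p_subgroup_conjg:
  assumes "g \<in> carrier G" and Q: "p_subgroup p Q"
  shows "p_subgroup p (conjg g ` Q)"
proof -
  have "Q \<subseteq> carrier G"
    using Q by (simp add: p_subgroup_def subgroup.subset)
  then show ?thesis
    using assms group_hom.subgroup_img_is_subgroup[OF conjg_hom]
    by (simp add: p_subgroup_def card_image inj_on_conjg)
qed

lemma p_subgroup_generate_p_element:
  assumes "x \<in> p_elements p G"
  shows "p_subgroup p (generate G {x})"
proof -
  have "x \<in> carrier G" "\<exists>m. ord x = p ^ m"
    using assms by (auto simp: p_elements_def)
  then show ?thesis
    using generate_is_subgroup[of "{x}"] generate_pow_card[of x] by (simp add: p_subgroup_def)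
qed

text \<open>The exponent \<open>n\<close> is prime to the order of \<open>x\<close>, a power of
  \<open>p\<close>, so Bezout makes \<open>x\<close> a power of \<open>x [^] n\<close>.\<close>

lemma subgroup_contains_generator:
  assumes H: "subgroup H G" and p: "Factorial_Ring.prime p" and x: "x \<in> p_elements p G"
    and n: "0 < n" "n < p" "x [^] n \<in> H"
  shows "x \<in> H"
proof -
  obtain m where xc: "x \<in> carrier G" and m: "ord x = p ^ m"
    using x by (auto simp: p_elements_def)
  have "coprime n (p ^ m)"
    using n(1,2) p
    by (meson coprime_power_right_iff coprime_commute nat_dvd_not_less prime_imp_coprime)
  then obtain a b :: int where ab: "a * int n + b * int (p ^ m) = 1"
    using bezout_int[of "int n" "int (p ^ m)"] by auto
  have "x = x [^] (a * int n + b * int (p ^ m))"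
    using xc ab by simp
  also have "\<dots> = (x [^] n) [^] a"
  proof -
    have "x [^] (b * int (p ^ m)) = \<one>"
      using xc m int_pow_eq_id[of x "b * int (p ^ m)"] by simp
    then show ?thesis
      using xc int_pow_pow[of x "int n" a] by (simp add: int_pow_mult int_pow_int mult.commute)
  qed
  finally show ?thesis
    using subgroup_int_pow_closed[OF H n(3)] by metis
qed

lemma p_elementsI:
  assumes p: "Factorial_Ring.prime p" and "x \<in> carrier G" "x [^] (p ^ m) = \<one>"
  shows "x \<in> p_elements p G"
  using assms divides_primepow_nat[OF p] pow_eq_id[of x "p ^ m"] by (auto simp: p_elements_def)

lemma p_elements_nat_pow:
  assumes p: "Factorial_Ring.prime p" and x: "x \<in> p_elements p G"
  shows "x [^] (n :: nat) \<in> p_elements p G"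
proof -
  obtain m where m: "x \<in> carrier G" "ord x = p ^ m"
    using x by (auto simp: p_elements_def)
  then have "(x [^] n) [^] (p ^ m) = \<one>"
    using pow_eq_id[of x "n * p ^ m"] by (simp add: nat_pow_pow)
  then show ?thesis
    using p_elementsI[OF p] m by simp
qed

lemma p_elements_mult:
  assumes p: "Factorial_Ring.prime p" and x: "x \<in> p_elements p G" and y: "y \<in> p_elements p G"
    and comm: "x \<otimes> y = y \<otimes> x"
  shows "x \<otimes> y \<in> p_elements p G"
proof -
  obtain m n where m: "x \<in> carrier G" "ord x = p ^ m" and n: "y \<in> carrier G" "ord y = p ^ n"
    using x y by (auto simp: p_elements_def)
  have "(x \<otimes> y) [^] (p ^ (m + n)) = x [^] (p ^ (m + n)) \<otimes> y [^] (p ^ (m + n))"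
    using pow_mult_distrib[OF comm] m n by simp
  also have "\<dots> = \<one>"
    using pow_eq_id[of x "p ^ (m + n)"] pow_eq_id[of y "p ^ (m + n)"] m n
    by (simp add: le_imp_power_dvd)
  finally show ?thesis
    using p_elementsI[OF p] m n by simp
qed

lemma conjg_generate:
  assumes "g \<in> carrier G" "A \<subseteq> carrier G" "conjg g ` A \<subseteq> A"
  shows "conjg g ` generate G A \<subseteq> generate G A"
  using group_hom.generate_img[OF conjg_hom, of g A] assms mono_generate[of "conjg g ` A" A] by simp

lemma p_subgroup_normalizer_grows:
  assumes p: "Factorial_Ring.prime p" and Q: "p_subgroup p Q"
    and S: "subgroup S G" "S \<subset> Q"
  shows "\<exists>g \<in> Q - S. conjg g ` S \<subseteq> S"
proof -
  obtain k where k: "subgroup Q G" "card Q = p ^ k"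
    using Q by (auto simp: p_subgroup_def)
  have "subgroup S (G\<lparr>carrier := Q\<rparr>)"
    using S k by (simp add: subgroup_incl)
  then obtain g where "g \<in> Q - S" "\<forall>s \<in> S. g \<otimes> s \<otimes> inv\<^bsub>G\<lparr>carrier := Q\<rparr>\<^esub> g \<in> S"
    using group.normalizer_grows[OF subgroup_imp_group[OF k(1)] p, of k S] S k
    by (auto simp: order_def)
  then show ?thesis
    using k by (intro bexI[of _ g]) (auto simp: conjg_def m_inv_consistent)
qed

text \<open>Rephrases normality inside \<open>U\<close> through conjugation in \<open>G\<close>, so
  that later arguments never leave the ambient group.\<close>

lemma normal_p_subgroup_iff:
  assumes U: "subgroup U G"
  shows "normal_p_subgroup p (G\<lparr>carrier := U\<rparr>) Q \<longleftrightarrow>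
    p_subgroup p Q \<and> Q \<subseteq> U \<and> (\<forall>u \<in> U. conjg u ` Q \<subseteq> Q)"
proof -
  have "subgroup Q (G\<lparr>carrier := U\<rparr>) \<longleftrightarrow> subgroup Q G \<and> Q \<subseteq> U"
    using incl_subgroup[OF U] subgroup_incl[OF _ U] subgroup.subset[of Q "G\<lparr>carrier := U\<rparr>"] by auto
  then show ?thesis
    using group.normal_inv_iff[OF subgroup_imp_group[OF U]] m_inv_consistent[OF U]
    by (auto simp: normal_p_subgroup_def p_subgroup_def conjg_def image_subset_iff)
qed

lemma
  assumes fin: "finite (carrier G)" and p: "Factorial_Ring.prime p" and U: "subgroup U G"
  shows p_core_subgroup: "p_subgroup p (p_core p (G\<lparr>carrier := U\<rparr>))"
      "p_core p (G\<lparr>carrier := U\<rparr>) \<subseteq> U"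
      "\<forall>u \<in> U. conjg u ` p_core p (G\<lparr>carrier := U\<rparr>) \<subseteq> p_core p (G\<lparr>carrier := U\<rparr>)"
    and p_core_subgroup_greatest: "p_subgroup p Q \<Longrightarrow> Q \<subseteq> U \<Longrightarrow> \<forall>u \<in> U. conjg u ` Q \<subseteq> Q \<Longrightarrow>
      Q \<subseteq> p_core p (G\<lparr>carrier := U\<rparr>)"
proof -
  have U': "group (G\<lparr>carrier := U\<rparr>)" "finite (carrier (G\<lparr>carrier := U\<rparr>))"
    using subgroup_imp_group[OF U] finite_subset[OF subgroup.subset[OF U] fin] by simp_all
  show "p_subgroup p (p_core p (G\<lparr>carrier := U\<rparr>))" "p_core p (G\<lparr>carrier := U\<rparr>) \<subseteq> U"
    "\<forall>u \<in> U. conjg u ` p_core p (G\<lparr>carrier := U\<rparr>) \<subseteq> p_core p (G\<lparr>carrier := U\<rparr>)"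
    using group.normal_p_subgroup_p_core[OF U' p] by (simp_all add: normal_p_subgroup_iff[OF U])
  show "Q \<subseteq> p_core p (G\<lparr>carrier := U\<rparr>)"
    if "p_subgroup p Q" "Q \<subseteq> U" "\<forall>u \<in> U. conjg u ` Q \<subseteq> Q"
    using group.p_core_greatest[OF U' p, of Q] that by (simp add: normal_p_subgroup_iff[OF U])
qed

text \<open>This is the set of \<open>p\<close>-elements of the centralizer of \<open>x\<close>,
  described inside \<open>G\<close>; \<open>p_elements_centralizer\<close> identifies the
  two.\<close>

definition p_centralizer :: "nat \<Rightarrow> 'a \<Rightarrow> 'a set"
  where "p_centralizer p x = {y \<in> p_elements p G. y \<otimes> x = x \<otimes> y}"

lemma p_centralizer_conjg:
  assumes g: "g \<in> carrier G" and x: "x \<in> carrier G"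
  shows "card (p_centralizer p (conjg g x)) = card (p_centralizer p x)"
proof -
  have sub: "conjg h ` p_centralizer p y \<subseteq> p_centralizer p (conjg h y)"
    if "h \<in> carrier G" "y \<in> carrier G" for h y
  proof
    fix z assume "z \<in> conjg h ` p_centralizer p y"
    then obtain w where w: "w \<in> p_elements p G" "w \<otimes> y = y \<otimes> w" "z = conjg h w"
      by (auto simp: p_centralizer_def)
    then have "w \<in> carrier G"
      by (simp add: p_elements_def)
    then show "z \<in> p_centralizer p (conjg h y)"
      using w that p_elements_conjg by (simp add: p_centralizer_def flip: conjg_mult_distrib)
  qed
  have c: "p_centralizer p y \<subseteq> carrier G" for y
    by (auto simp: p_centralizer_def p_elements_def)
  \<comment> \<open>The reverse inclusion is \<open>sub\<close> for \<open>inv g\<close>, carried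
    back by \<open>g\<close>.\<close>
  have "p_centralizer p (conjg g x) = conjg g ` conjg (inv g) ` p_centralizer p (conjg g x)"
    using g c by (simp add: conjg_image_conjg)
  also have "\<dots> \<subseteq> conjg g ` p_centralizer p x"
    using sub[of "inv g" "conjg g x"] g x by (intro image_mono) simp
  finally have "conjg g ` p_centralizer p x = p_centralizer p (conjg g x)"
    using sub[OF g x] by blast
  moreover have "card (conjg g ` p_centralizer p x) = card (p_centralizer p x)"
    by (rule card_image[OF inj_on_conjg[OF g c]])
  ultimately show ?thesis
    by simp
qed

end

section \<open>Blocks in a minimal subgroup\<close>

text \<open>Here \<open>K\<close> stands for the conjugates of \<open>x\<close> in \<open>U\<close>
  outside the \<open>p\<close>-core of \<open>U\<close>. The assumption \<open>proper\<close> is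
  what minimality of \<open>U\<close> gives, with the \<open>p\<close>-core of \<open>V\<close> as
  \<open>Q\<close>; \<open>not_normal\<close> says that \<open>K\<close> avoids the
  \<open>p\<close>-core of \<open>U\<close>. The cores themselves thus stay out of the block
  argument.\<close>

locale minimal_outside_p_core = group G for G (structure) +
  fixes p :: nat and U K :: "'a set"
  assumes finite_carrier: "finite (carrier G)"
    and prime: "Factorial_Ring.prime p"
    and U: "subgroup U G"
    and K: "K \<subseteq> U" "K \<subseteq> p_elements p G"
    and conjg_K: "u \<in> U \<Longrightarrow> k \<in> K \<Longrightarrow> conjg u k \<in> K"
    and proper: "subgroup V G \<Longrightarrow> V \<subset> U \<Longrightarrow> \<exists>Q. p_subgroup p Q \<and> Q \<subseteq> V \<and> K \<inter> V \<subseteq> Q"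
    and not_normal: "p_subgroup p Q \<Longrightarrow> Q \<subseteq> U \<Longrightarrow> \<forall>u \<in> U. conjg u ` Q \<subseteq> Q \<Longrightarrow> Q \<inter> K = {}"
begin

definition traces :: "'a set set"
  where "traces = {Q \<inter> K |Q. p_subgroup p Q \<and> Q \<subseteq> U}"

definition blocks :: "'a set set"
  where "blocks = {T \<in> traces. T \<noteq> {} \<and> (\<forall>T' \<in> traces. T \<subseteq> T' \<longrightarrow> T' = T)}"

text \<open>The normalizer in \<open>U\<close> of the set \<open>A\<close>.\<close>

definition stab :: "'a set \<Rightarrow> 'a set"
  where "stab A = {u \<in> U. conjg u ` A = A}"

lemma U_carrier: "u \<in> U \<Longrightarrow> u \<in> carrier G"
  by (rule subgroup.mem_carrier[OF U])

lemma K_carrier: "K \<subseteq> carrier G"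
  using K(1) subgroup.subset[OF U] by (rule subset_trans)

lemma finite_K: "finite K"
  using K_carrier finite_carrier by (rule finite_subset)

lemma inv_U: "u \<in> U \<Longrightarrow> inv u \<in> U"
  by (rule subgroup.m_inv_closed[OF U])

lemma mult_U: "u \<in> U \<Longrightarrow> v \<in> U \<Longrightarrow> u \<otimes> v \<in> U"
  by (rule subgroup.m_closed[OF U])

lemma traceI: "p_subgroup p Q \<Longrightarrow> Q \<subseteq> U \<Longrightarrow> Q \<inter> K \<in> traces"
  unfolding traces_def by blast

lemma traceE:
  assumes "T \<in> traces"
  obtains Q where "T = Q \<inter> K" "p_subgroup p Q" "Q \<subseteq> U"
  using assms unfolding traces_def by blast

lemma traces_subset: "T \<in> traces \<Longrightarrow> T \<subseteq> K"
  by (auto simp: traces_def)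

lemma finite_traces: "finite traces"
  by (rule finite_subset[of _ "Pow K"]) (use finite_K traces_subset in auto)

lemma stab_subset: "stab A \<subseteq> U"
  by (auto simp: stab_def)

lemma subgroup_stab:
  assumes A: "A \<subseteq> carrier G"
  shows "subgroup (stab A) G"
proof (rule subgroupI)
  show "stab A \<subseteq> carrier G"
    by (auto simp: stab_def U_carrier)
  show "stab A \<noteq> {}"
    using A subgroup.one_closed[OF U] conjg_image_one[OF A] unfolding stab_def by blast
  show "inv u \<in> stab A" if "u \<in> stab A" for u
  proof -
    have u: "u \<in> carrier G" "u \<in> U" "conjg u ` A = A"
      using that by (auto simp: stab_def U_carrier)
    have "conjg (inv u) ` conjg u ` A = A"
      using u(1) A by (simp add: conjg_image_conjg)
    then show ?thesis
      using u by (simp add: stab_def inv_U)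
  qed
  show "u \<otimes> v \<in> stab A" if "u \<in> stab A" "v \<in> stab A" for u v
    using that A conjg_image_conjg[of u v A] by (auto simp: stab_def U_carrier mult_U)
qed

text \<open>If all of \<open>U\<close> normalized \<open>A\<close>, it would normalize the
  \<open>p\<close>-subgroup generated by \<open>A\<close>, which meets \<open>K\<close>, against
  \<open>not_normal\<close>.\<close>

lemma stab_proper:
  assumes "p_subgroup p Q" "Q \<subseteq> U" "A \<subseteq> Q \<inter> K" "A \<noteq> {}"
  shows "stab A \<subset> U"
proof -
  have A: "A \<subseteq> carrier G"
    using assms(3) K_carrier by blast
  have "generate G A \<subseteq> Q"
    using assms generate_subgroup_incl by (auto simp: p_subgroup_def)
  then have "p_subgroup p (generate G A)" "generate G A \<subseteq> U"
    using p_subgroup_subset[OF prime] generate_is_subgroup A assms by auto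
  moreover have "A \<subseteq> generate G A"
    by (auto intro: generate.incl)
  ultimately have "\<not> (\<forall>u \<in> U. conjg u ` generate G A \<subseteq> generate G A)"
    using assms not_normal by blast
  then obtain u where u: "u \<in> U" "\<not> conjg u ` generate G A \<subseteq> generate G A"
    by blast
  then have "conjg u ` A \<noteq> A"
    using conjg_generate[OF U_carrier[OF u(1)] A] by auto
  then show ?thesis
    using u(1) by (auto simp: stab_def)
qed

lemma ex_block:
  assumes "T \<in> traces" "T \<noteq> {}"
  shows "\<exists>B \<in> blocks. T \<subseteq> B"
proof -
  obtain B where B: "B \<in> traces" "T \<subseteq> B" "\<forall>T' \<in> traces. B \<subseteq> T' \<longrightarrow> B = T'"
    using finite_has_maximal2[OF finite_traces assms(1)] by metis
  then have "B \<in> blocks"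
    using assms(2) by (auto simp: blocks_def)
  then show ?thesis
    using B(2) by blast
qed

text \<open>By \<open>proper\<close>, the members of \<open>K\<close> in the proper subgroup
  \<open>stab A\<close> lie in one \<open>p\<close>-subgroup, whose trace extends to a maximal
  one.\<close>

lemma stab_block:
  assumes "A \<subseteq> K" "stab A \<subset> U" "A \<subseteq> stab A" "A \<noteq> {}"
  shows "\<exists>B \<in> blocks. K \<inter> stab A \<subseteq> B"
proof -
  obtain Q where Q: "p_subgroup p Q" "Q \<subseteq> stab A" "K \<inter> stab A \<subseteq> Q"
    using proper[OF subgroup_stab assms(2)] assms(1) K_carrier by blast
  have "Q \<inter> K \<in> traces"
    using Q(1) subset_trans[OF Q(2) stab_subset] by (rule traceI)
  moreover have "Q \<inter> K \<noteq> {}"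
    using assms(1,3,4) Q(3) by blast
  ultimately obtain B where "B \<in> blocks" "Q \<inter> K \<subseteq> B"
    using ex_block[of "Q \<inter> K"] by blast
  then show ?thesis
    using Q(3) by blast
qed

lemma conjg_image_K: "u \<in> U \<Longrightarrow> conjg u ` K = K"
  by (rule conjg_image_eq) (auto simp: U_carrier K_carrier finite_K conjg_K)

lemma conjg_image_trace:
  assumes u: "u \<in> U" and T: "T \<in> traces"
  shows "conjg u ` T \<in> traces"
proof -
  obtain Q where Q: "T = Q \<inter> K" "p_subgroup p Q" "Q \<subseteq> U"
    using T by (auto simp: traces_def)
  have "inj_on (conjg u) U"
    using u U_carrier inj_on_conjg subgroup.subset[OF U] by blast
  then have "conjg u ` T = conjg u ` Q \<inter> K"
    using Q K conjg_image_K[OF u] by (metis inj_on_image_Int)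
  moreover have "p_subgroup p (conjg u ` Q)"
    using Q u U_carrier p_subgroup_conjg by blast
  moreover have "conjg u ` Q \<subseteq> U"
    using Q(3) u by (auto simp: conjg_def mult_U inv_U)
  ultimately show ?thesis
    by (auto simp: traces_def)
qed

lemma conjg_image_block:
  assumes u: "u \<in> U" and B: "B \<in> blocks"
  shows "conjg u ` B \<in> blocks"
proof -
  have T: "B \<in> traces" "B \<noteq> {}"
    using B by (auto simp: blocks_def)
  have "T = conjg u ` B" if "T \<in> traces" "conjg u ` B \<subseteq> T" for T
  proof -
    have sub: "B \<subseteq> carrier G" "T \<subseteq> carrier G"
      using traces_subset K_carrier T that by blast+
    have "conjg (inv u) ` conjg u ` B = B"
      using u U_carrier sub by (simp add: conjg_image_conjg)
    then have "B \<subseteq> conjg (inv u) ` T"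
      using that by blast
    then have "conjg (inv u) ` T = B"
      using B that conjg_image_trace inv_U u by (auto simp: blocks_def)
    then have "conjg u ` conjg (inv u) ` T = conjg u ` B"
      by simp
    then show ?thesis
      using u U_carrier sub by (simp add: conjg_image_conjg)
  qed
  then show ?thesis
    using T conjg_image_trace u by (auto simp: blocks_def)
qed

text \<open>Elements of a trace lie in the \<open>p\<close>-subgroup \<open>Q\<close> cutting it
  out, and \<open>Q\<close> normalizes both itself and \<open>K\<close>.\<close>

lemma trace_subset_stab:
  assumes "T \<in> traces" "g \<in> T"
  shows "conjg g ` T = T"
proof (rule conjg_image_eq)
  obtain Q where Q: "T = Q \<inter> K" "subgroup Q G" "Q \<subseteq> U"
    using assms by (auto simp: traces_def p_subgroup_def)
  show "conjg g ` T \<subseteq> T"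
    using Q assms(2) conjg_K
    by (auto simp: conjg_def subgroup.m_closed subgroup.m_inv_closed)
  show "T \<subseteq> carrier G" "g \<in> carrier G" "finite T"
    using assms traces_subset K_carrier finite_K finite_subset by blast+
qed

text \<open>Normalizers grow in the \<open>p\<close>-group carrying a block, so the stabilizer of the
  intersection of two blocks would meet each of them in more than the intersection.\<close>

lemma trace_grows:
  assumes T: "T \<in> traces" and A: "A \<subset> T" "A \<subseteq> stab A"
  shows "\<exists>t \<in> T - A. t \<in> stab A"
proof -
  obtain Q where Q: "T = Q \<inter> K" "p_subgroup p Q" "Q \<subseteq> U"
    using T by (auto simp: traces_def)
  have AK: "A \<subseteq> carrier G" "finite A"
    using A Q K_carrier finite_K finite_subset by blast+
  have QT: "conjg q ` T \<subseteq> T" if "q \<in> Q" for q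
    using that Q conjg_K
    by (auto simp: conjg_def p_subgroup_def subgroup.m_closed subgroup.m_inv_closed)
  \<comment> \<open>The normalizer of \<open>A\<close> in \<open>Q\<close>. If it is all of
    \<open>Q\<close>, any member of \<open>T - A\<close> serves.\<close>
  let ?S = "Q \<inter> stab A"
  show ?thesis
  proof (cases "?S = Q")
    case True
    then show ?thesis
      using A Q by blast
  next
    case False
    have "subgroup ?S G"
      using Q subgroup_stab AK by (auto simp: p_subgroup_def subgroups_Inter_pair)
    then obtain g where g: "g \<in> Q - ?S" "conjg g ` ?S \<subseteq> ?S"
      using p_subgroup_normalizer_grows[OF prime Q(2), of ?S] False by blast
    have gc: "g \<in> carrier G"
      using g Q U_carrier by blast
    \<comment> \<open>\<open>g\<close> normalizes \<open>?S\<close> but not \<open>A\<close>, so it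
      moves some \<open>a\<close> in \<open>A\<close> out of \<open>A\<close>. The image stays in
      \<open>T\<close>, which \<open>Q\<close> normalizes, and in \<open>?S\<close>, which contains
      \<open>A\<close>.\<close>
    have "conjg g ` A \<noteq> A"
      using g Q by (auto simp: stab_def)
    then have "\<not> conjg g ` A \<subseteq> A"
      using conjg_image_eq gc AK by blast
    then obtain a where a: "a \<in> A" "conjg g a \<notin> A"
      by blast
    then have "conjg g a \<in> T"
      using QT[of g] g A by blast
    moreover have "conjg g a \<in> stab A"
      using g a A Q by blast
    ultimately show ?thesis
      using a by blast
  qed
qed

lemma blocks_disjoint:
  assumes "B \<in> blocks" "C \<in> blocks" "B \<inter> C \<noteq> {}"
  shows "B = C"
  using assms
\<comment> \<open>Downward induction on the size of the intersection: the hypothesis covers pairs of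
  blocks that meet in more elements.\<close>
proof (induction "card K - card (B \<inter> C)" arbitrary: B C rule: less_induct)
  case less
  show ?case
  proof (rule ccontr)
    assume neq: "B \<noteq> C"
    define A where "A = B \<inter> C"
    have tr: "B \<in> traces" "C \<in> traces"
      using less.prems by (auto simp: blocks_def)
    have AB: "A \<subset> B" and AC: "A \<subset> C"
      using less.prems neq by (auto simp: blocks_def A_def)
    have AK: "A \<subseteq> K" "A \<noteq> {}"
      using less.prems(3) tr traces_subset by (auto simp: A_def)
    \<comment> \<open>A common element of two blocks normalizes both, hence their
      intersection.\<close>
    have stab: "A \<subseteq> stab A"
    proof
      fix a assume a: "a \<in> A"
      then have "conjg a ` A \<subseteq> A"
        using trace_subset_stab tr by (auto simp: A_def)
      then have "conjg a ` A = A"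
        using conjg_image_eq a AK K_carrier finite_K finite_subset by (metis subset_iff)
      then show "a \<in> stab A"
        using a AK K by (auto simp: stab_def)
    qed
    obtain Q where Q: "B = Q \<inter> K" "p_subgroup p Q" "Q \<subseteq> U"
      using tr(1) by (rule traceE)
    then have "stab A \<subset> U"
      using stab_proper[OF Q(2,3) _ AK(2)] AB by blast
    then obtain D where D: "D \<in> blocks" "K \<inter> stab A \<subseteq> D"
      using stab_block[OF AK(1) _ stab AK(2)] by blast
    \<comment> \<open>By \<open>trace_grows\<close>, \<open>D\<close> meets any block
      \<open>E\<close> properly containing \<open>A\<close> in more than \<open>A\<close>, so the
      induction hypothesis applies. Taking \<open>B\<close> and \<open>C\<close> for
      \<open>E\<close> then gives \<open>B = D = C\<close>.\<close>
    have eq: "D = E" if E: "E \<in> blocks" "E \<in> traces" "A \<subset> E" for E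
    proof (rule less.hyps[OF _ D(1) E(1)])
      obtain t where t: "t \<in> E - A" "t \<in> stab A"
        using trace_grows[OF E(2,3) stab] by blast
      have "A \<subset> D \<inter> E"
        using D t stab AK E(3) traces_subset[OF E(2)] by blast
      have "D \<inter> E \<subseteq> K"
        using traces_subset[OF E(2)] by blast
      then have "finite (D \<inter> E)" "card (D \<inter> E) \<le> card K"
        using finite_K by (auto intro: finite_subset card_mono)
      then have "card A < card (D \<inter> E)" "card (D \<inter> E) \<le> card K"
        using \<open>A \<subset> D \<inter> E\<close> psubset_card_mono by blast+
      then show "card K - card (D \<inter> E) < card K - card (B \<inter> C)"
        by (simp add: A_def)
      show "D \<inter> E \<noteq> {}"
        using \<open>A \<subset> D \<inter> E\<close> by blast
    qed
    then show False
      using eq[OF less.prems(1) tr(1) AB] eq[OF less.prems(2) tr(2) AC] neq by simp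
  qed
qed

text \<open>\<open>K \<inter> stab B\<close> lies in a single block and contains \<open>B\<close>,
  so by disjointness that block is \<open>B\<close>. Hence a member of \<open>K\<close> outside
  \<open>B\<close> cannot fix \<open>B\<close>.\<close>

lemma stab_block_Int:
  assumes B: "B \<in> blocks"
  shows "K \<inter> stab B \<subseteq> B"
proof -
  obtain Q where Q: "B = Q \<inter> K" "p_subgroup p Q" "Q \<subseteq> U" and tr: "B \<in> traces" "B \<noteq> {}"
    using B by (auto simp: blocks_def traces_def)
  then have "stab B \<subset> U"
    using stab_proper[OF Q(2,3), of B] by blast
  moreover have sub: "B \<subseteq> stab B"
    using trace_subset_stab tr Q by (auto simp: stab_def)
  ultimately obtain D where D: "D \<in> blocks" "K \<inter> stab B \<subseteq> D"
    using stab_block[of B] Q(1) tr by blast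
  then have "D = B"
    using blocks_disjoint[OF D(1) B] sub tr(2) Q(1) by blast
  then show ?thesis
    using D by simp
qed

text \<open>Were \<open>V\<close> proper, \<open>K \<inter> V\<close> would lie in one
  \<open>p\<close>-subgroup and so in one block, which would contain both \<open>b\<close> and
  \<open>c\<close>.\<close>

lemma block_generates:
  assumes "B \<in> blocks" "C \<in> blocks" "B \<noteq> C" "b \<in> B" "c \<in> C"
    and V: "subgroup V G" "V \<subseteq> U" "b \<in> V" "c \<in> V"
  shows "V = U"
proof (rule ccontr)
  assume "V \<noteq> U"
  then obtain Q where Q: "p_subgroup p Q" "Q \<subseteq> V" "K \<inter> V \<subseteq> Q"
    using proper[OF V(1)] V(2) by blast
  have bc: "b \<in> K" "c \<in> K"
    using assms traces_subset by (auto simp: blocks_def)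
  have "Q \<inter> K \<in> traces"
    using Q(1) subset_trans[OF Q(2) V(2)] by (rule traceI)
  moreover have bcQ: "b \<in> Q \<inter> K" "c \<in> Q \<inter> K"
    using bc Q(3) V(3,4) by blast+
  ultimately obtain D where D: "D \<in> blocks" "Q \<inter> K \<subseteq> D"
    using ex_block[of "Q \<inter> K"] by blast
  then have "B = D" "C = D"
    using assms(1,2,4,5) bcQ blocks_disjoint[of B D] blocks_disjoint[of C D] by blast+
  then show False
    using assms by simp
qed

lemma ex_block_containing:
  assumes k: "k \<in> K"
  shows "\<exists>B \<in> blocks. k \<in> B"
proof -
  have "p_subgroup p (generate G {k})"
    using k K(2) by (intro p_subgroup_generate_p_element) blast
  moreover have "generate G {k} \<subseteq> U"
    using k K(1) by (intro generate_subgroup_incl[OF _ U]) blast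
  ultimately have "generate G {k} \<inter> K \<in> traces"
    by (rule traceI)
  moreover have "k \<in> generate G {k} \<inter> K"
    using k by (simp add: generate.incl)
  ultimately show ?thesis
    using ex_block[of "generate G {k} \<inter> K"] by blast
qed

text \<open>The element \<open>x\<close> acts by conjugation on the blocks and fixes only its own one.\<close>

lemma ex_generating_family:
  assumes x: "x \<in> K"
  shows "\<exists>f. (\<forall>i \<le> p. f i \<in> K) \<and>
    (\<forall>i \<le> p. \<forall>j \<le> p. \<forall>V. i \<noteq> j \<longrightarrow> subgroup V G \<longrightarrow> V \<subseteq> U \<longrightarrow> f i \<in> V \<longrightarrow> f j \<in> V \<longrightarrow> V = U)"
proof -
  have xU: "x \<in> U" and xc: "x \<in> carrier G"
    using x K U_carrier by auto
  have xp: "x \<in> p_elements p G"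
    using x K(2) by blast
  obtain B where B: "B \<in> blocks" "x \<in> B"
    using ex_block_containing[OF x] by metis
  have trB: "B \<in> traces"
    using B by (auto simp: blocks_def)
  \<comment> \<open>Otherwise \<open>K\<close> is itself a trace, although all of \<open>U\<close>
    normalizes it, against \<open>stab_proper\<close>.\<close>
  have "B \<noteq> K"
  proof
    assume "B = K"
    moreover obtain Q where Q: "B = Q \<inter> K" "p_subgroup p Q" "Q \<subseteq> U"
      using trB by (auto simp: traces_def)
    ultimately have "stab K \<subset> U"
      using stab_proper[of Q K] x by blast
    then show False
      using conjg_image_K by (auto simp: stab_def)
  qed
  then obtain v where v: "v \<in> K" "v \<notin> B"
    using trB traces_subset by blast
  obtain C where C: "C \<in> blocks" "v \<in> C"
    using ex_block_containing[OF v(1)] by blast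
  have CK: "C \<subseteq> carrier G"
    using C traces_subset K_carrier by (auto simp: blocks_def)
  have BK: "B \<subseteq> carrier G"
    using traces_subset[OF trB] K_carrier by (rule subset_trans)
  have xC: "x \<notin> C"
    using blocks_disjoint[OF B(1) C(1)] B C v by blast
  have xnU: "x [^] n \<in> U" for n :: nat
    using U xU by (induction n) (auto simp: subgroup.one_closed mult_U)
  have xB: "conjg (x [^] n) ` B = B" for n :: nat
  proof (induction n)
    case (Suc n)
    have "conjg (x [^] Suc n) ` B = conjg (x [^] n) ` conjg x ` B"
      using xc BK by (subst conjg_image_conjg) auto
    then show ?case
      using Suc trace_subset_stab[OF trB B(2)] by simp
  qed (use BK in simp)
  \<comment> \<open>If \<open>x [^] n\<close> fixed \<open>C\<close>, then so would
    \<open>x\<close>, forcing \<open>x\<close> into \<open>C\<close> by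
    \<open>stab_block_Int\<close>.\<close>
  have move: "conjg (x [^] n) ` C \<noteq> C" if n: "0 < n" "n < p" for n :: nat
  proof
    assume "conjg (x [^] n) ` C = C"
    then have "x [^] n \<in> stab C"
      using xnU by (simp add: stab_def)
    then have "x \<in> stab C"
      using subgroup_contains_generator[OF subgroup_stab[OF CK] prime xp n] by blast
    then show False
      using stab_block_Int[OF C(1)] x xC by blast
  qed
  \<comment> \<open>The indices below \<open>p\<close> run through conjugates of \<open>v\<close> in
    the translates of \<open>C\<close>; the last index \<open>p\<close> stands for \<open>x\<close>
    in its own block \<open>B\<close>. \<open>F i\<close> is the block of
    \<open>f i\<close>.\<close>
  define f where "f i = (if i = p then x else conjg (x [^] i) v)" for i
  define F where "F i = (if i = p then B else conjg (x [^] i) ` C)" for i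
  have fF: "f i \<in> F i" "F i \<in> blocks" "f i \<in> K" if "i \<le> p" for i
    using B C x v by (auto simp: f_def F_def conjg_image_block xnU conjg_K)
  have neq: "F i \<noteq> F j" if "i < j" "j \<le> p" for i j
  proof
    assume eq: "F i = F j"
    show False
    proof (cases "j = p")
      case True
      \<comment> \<open>\<open>B\<close> is fixed by all powers of \<open>x\<close>, so it may be
        written as a translate by \<open>x [^] i\<close>, which then cancels.\<close>
      then have "conjg (x [^] i) ` C = conjg (x [^] i) ` B"
        using eq that xB by (simp add: F_def)
      then have "C = B"
        using inj_on_image_eq_iff[OF inj_on_conjg[of "x [^] i" "carrier G"]] CK xc trB
          traces_subset K_carrier by (meson nat_pow_closed order_refl subset_trans)
      then show False
        using C v by simp
    next
      case False
      have "x [^] j = x [^] i \<otimes> x [^] (j - i)"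
        using that xc by (simp add: nat_pow_mult)
      then have "conjg (x [^] i) ` C = conjg (x [^] i) ` conjg (x [^] (j - i)) ` C"
        using eq that False xc CK by (simp add: F_def conjg_image_conjg)
      moreover have "conjg (x [^] (j - i)) ` C \<subseteq> carrier G"
        using CK xc by auto
      ultimately have "C = conjg (x [^] (j - i)) ` C"
        using inj_on_image_eq_iff[OF inj_on_conjg[of "x [^] i" "carrier G"]] CK xc
        by (meson nat_pow_closed order_refl)
      moreover have "0 < j - i" "j - i < p"
        using that False by auto
      ultimately show False
        using move[of "j - i"] by simp
    qed
  qed
  have "V = U" if "i \<le> p" "j \<le> p" "i \<noteq> j" "subgroup V G" "V \<subseteq> U" "f i \<in> V" "f j \<in> V" for i j V
  proof -
    have "F i \<noteq> F j"
      using neq[of i j] neq[of j i] that by (metis nat_neq_iff)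
    then show ?thesis
      using block_generates fF that by metis
  qed
  then show ?thesis
    using fF by (intro exI[of _ f]) blast
qed

section \<open>Counting\<close>

text \<open>The set called \<open>I\<close> in the overview: the \<open>p\<close>-elements that
  centralize \<open>U\<close>.\<close>

definition p_centralizer_U :: "'a set"
  where "p_centralizer_U = p_elements p G \<inter> (\<Inter>u \<in> U. centralizer G u)"

lemma subgroup_centralizer_U: "subgroup (\<Inter>u \<in> U. centralizer G u) G"
  using subgroup.one_closed[OF U] U_carrier subgroup_centralizer by (intro subgroups_Inter) auto

text \<open>If \<open>k\<close> centralized \<open>U\<close>, the cyclic \<open>p\<close>-group it
  generates would be normalized by \<open>U\<close> and meet \<open>K\<close>.\<close>

lemma not_central:
  assumes k: "k \<in> K"
  shows "k \<notin> (\<Inter>u \<in> U. centralizer G u)"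
proof
  assume c: "k \<in> (\<Inter>u \<in> U. centralizer G u)"
  have kc: "k \<in> carrier G"
    using k K_carrier by blast
  have Q: "p_subgroup p (generate G {k})"
    using k K(2) by (intro p_subgroup_generate_p_element) blast
  moreover have "generate G {k} \<subseteq> U"
    using k K(1) by (intro generate_subgroup_incl[OF _ U]) blast
  moreover have "\<forall>u \<in> U. conjg u ` generate G {k} \<subseteq> generate G {k}"
  proof (intro ballI conjg_generate)
    fix u assume u: "u \<in> U"
    have "k \<otimes> u = u \<otimes> k"
      using c u by (auto simp: centralizer_def)
    then have "conjg u k = k"
      using kc U_carrier[OF u] inv_solve_right'[of k "u \<otimes> k" u] by (simp add: conjg_def)
    then show "conjg u ` {k} \<subseteq> {k}"
      by simp
  qed (use kc U_carrier in auto)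
  ultimately have "generate G {k} \<inter> K = {}"
    by (rule not_normal)
  then show False
    using k generate.incl[of k "{k}" G] by blast
qed

text \<open>The products \<open>z \<otimes> k [^] n\<close> with \<open>z\<close> in
  \<open>p_centralizer_U\<close> and \<open>n < p\<close> are distinct \<open>p\<close>-elements
  commuting with \<open>k\<close>.\<close>

lemma card_p_centralizer_U:
  assumes k: "k \<in> K"
  shows "p * card p_centralizer_U \<le> card (p_centralizer p k)"
proof -
  let ?Z = "\<Inter>u \<in> U. centralizer G u"
  have kc: "k \<in> carrier G" and kp: "k \<in> p_elements p G" and kU: "k \<in> U"
    using k K K_carrier by auto
  have zc: "z \<in> carrier G" "z \<otimes> k = k \<otimes> z" if "z \<in> ?Z" for z
    using that kU by (auto simp: centralizer_def)
  have zk: "z \<otimes> k [^] n = k [^] n \<otimes> z" if "z \<in> ?Z" for z and n :: nat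
    using group_commutes_pow[of k z n] zc[OF that] kc by simp
  let ?f = "\<lambda>(z, n :: nat). z \<otimes> k [^] n"
  have "inj_on ?f (p_centralizer_U \<times> {..<p})"
  proof -
    have eq: "m = n" if "z \<in> ?Z" "w \<in> ?Z" "m \<le> n" "n < p" "z \<otimes> k [^] m = w \<otimes> k [^] n"
      for z w and m n :: nat
    proof (rule ccontr)
      assume "m \<noteq> n"
      have "k [^] n = k [^] (n - m) \<otimes> k [^] m"
        using kc that by (simp add: nat_pow_mult)
      then have "z \<otimes> k [^] m = w \<otimes> k [^] (n - m) \<otimes> k [^] m"
        using that kc zc by (simp add: m_assoc)
      then have "z = w \<otimes> k [^] (n - m)"
        using that kc zc by simp
      \<comment> \<open>A collision puts a power of \<open>k\<close> with exponent strictly between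
        0 and \<open>p\<close> into the centralizer of \<open>U\<close>, hence \<open>k\<close>
        itself.\<close>
      then have "inv w \<otimes> z = k [^] (n - m)"
        using that kc zc by (simp add: inv_solve_left')
      moreover have "inv w \<otimes> z \<in> ?Z"
        using that by (intro subgroup.m_closed[OF subgroup_centralizer_U]
            subgroup.m_inv_closed[OF subgroup_centralizer_U])
      ultimately have "k \<in> ?Z"
        using subgroup_contains_generator[OF subgroup_centralizer_U prime kp, of "n - m"]
          that \<open>m \<noteq> n\<close> by simp
      then show False
        using not_central[OF k] by blast
    qed
    have "z = w \<and> m = n" if zw: "z \<in> ?Z" "w \<in> ?Z" and mn: "m < p" "n < p"
      and e: "z \<otimes> k [^] m = w \<otimes> k [^] n" for z w and m n :: nat
    proof -
      have "m = n"
        using eq[OF zw _ mn(2) e] eq[OF zw(2,1) _ mn(1) e[symmetric]] by linarith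
      then show ?thesis
        using e zc[OF zw(1)] zc[OF zw(2)] kc by simp
    qed
    then show ?thesis
      unfolding inj_on_def p_centralizer_U_def by clarsimp
  qed
  moreover have "?f ` (p_centralizer_U \<times> {..<p}) \<subseteq> p_centralizer p k"
  proof -
    have "z \<otimes> k [^] n \<in> p_centralizer p k" if z: "z \<in> p_elements p G" "z \<in> ?Z" for z and n :: nat
    proof -
      have "z \<otimes> k [^] n \<in> p_elements p G"
        by (rule p_elements_mult[OF prime z(1) p_elements_nat_pow[OF prime kp] zk[OF z(2)]])
      moreover have "z \<otimes> k [^] n \<otimes> k = k \<otimes> (z \<otimes> k [^] n)"
      proof -
        have "z \<otimes> k [^] n \<otimes> k = z \<otimes> k \<otimes> k [^] n"
          using kc zc(1)[OF z(2)] nat_pow_comm[of k n 1] by (simp add: m_assoc)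
        also have "\<dots> = k \<otimes> z \<otimes> k [^] n"
          by (simp only: zc(2)[OF z(2)])
        finally show ?thesis
          using kc zc(1)[OF z(2)] by (simp add: m_assoc)
      qed
      ultimately show ?thesis
        by (simp add: p_centralizer_def)
    qed
    then show ?thesis
      by (auto simp: p_centralizer_U_def)
  qed
  moreover have "finite (p_centralizer p k)"
    using finite_carrier by (auto simp: p_centralizer_def p_elements_def)
  ultimately have "card (p_centralizer_U \<times> {..<p}) \<le> card (p_centralizer p k)"
    by (rule card_inj_on_le)
  then show ?thesis
    by (simp add: card_cartesian_product mult.commute)
qed

text \<open>The \<open>p + 1\<close> sets \<open>p_centralizer p (f i)\<close> pairwise intersect in \<open>p_centralizer_U\<close>.\<close>

lemma p_centralizer_bound:
  assumes k: "k \<in> K" and conj: "\<And>l. l \<in> K \<Longrightarrow> card (p_centralizer p l) = c"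
  shows "p * c \<le> card (p_elements p G)"
proof -
  obtain f where fK: "\<And>i. i \<le> p \<Longrightarrow> f i \<in> K"
    and gen: "\<And>i j V. i \<le> p \<Longrightarrow> j \<le> p \<Longrightarrow> i \<noteq> j \<Longrightarrow> subgroup V G \<Longrightarrow> V \<subseteq> U \<Longrightarrow>
        f i \<in> V \<Longrightarrow> f j \<in> V \<Longrightarrow> V = U"
    using ex_generating_family[OF k] by metis
  let ?I = "p_centralizer_U" and ?A = "\<lambda>i. p_centralizer p (f i)"
  have fin: "finite (p_elements p G)"
    using finite_carrier by (simp add: p_elements_def)
  have IA: "?I \<subseteq> ?A i" if "i \<le> p" for i
    using fK[OF that] K(1) by (auto simp: p_centralizer_U_def p_centralizer_def centralizer_def)
  have AA: "?A i \<inter> ?A j \<subseteq> ?I" if ij: "i \<le> p" "j \<le> p" "i \<noteq> j" for i j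
  proof
    fix g assume g: "g \<in> ?A i \<inter> ?A j"
    then have gp: "g \<in> p_elements p G" and gc: "g \<in> carrier G"
      by (auto simp: p_centralizer_def p_elements_def)
    \<comment> \<open>This intersection is a subgroup of \<open>U\<close> containing
      \<open>f i\<close> and \<open>f j\<close>, which together generate \<open>U\<close>.\<close>
    have "U \<inter> centralizer G g = U"
    proof (rule gen[OF ij])
      show "subgroup (U \<inter> centralizer G g) G"
        by (rule subgroups_Inter_pair[OF U subgroup_centralizer[OF gc]])
      show "f i \<in> U \<inter> centralizer G g" "f j \<in> U \<inter> centralizer G g"
        using g fK ij K(1) K_carrier by (auto simp: p_centralizer_def centralizer_def)
    qed simp
    then have "U \<subseteq> centralizer G g"
      by blast
    then show "g \<in> ?I"
      using gp gc by (auto simp: p_centralizer_U_def centralizer_def subset_iff)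
  qed
  have finA: "finite (?A i)" for i
    using fin by (simp add: p_centralizer_def)
  have finI: "finite ?I"
    using fin by (simp add: p_centralizer_U_def)
  have "card (\<Union>i \<le> p. ?A i - ?I) = (\<Sum>i \<le> p. card (?A i - ?I))"
    using AA finA by (intro card_UN_disjoint) auto
  also have "\<dots> = (\<Sum>i \<le> p. c - card ?I)"
    by (intro sum.cong) (simp_all add: card_Diff_subset finI IA conj fK)
  finally have "card (\<Union>i \<le> p. ?A i - ?I) = (p + 1) * (c - card ?I)"
    by simp
  moreover have "card (?I \<union> (\<Union>i \<le> p. ?A i - ?I)) = card ?I + card (\<Union>i \<le> p. ?A i - ?I)"
    using finI finA by (intro card_Un_disjoint) auto
  moreover have "card (?I \<union> (\<Union>i \<le> p. ?A i - ?I)) \<le> card (p_elements p G)"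
    using fin by (intro card_mono) (auto simp: p_centralizer_U_def p_centralizer_def)
  ultimately have le: "card ?I + (p + 1) * (c - card ?I) \<le> card (p_elements p G)"
    by simp
  have I: "p * card ?I \<le> c"
    using card_p_centralizer_U[OF k] conj[OF k] by simp
  \<comment> \<open>Makes the truncated difference \<open>c - card ?I\<close> a true one, named
    \<open>d\<close> below.\<close>
  have "card ?I \<le> c"
    using card_mono[OF finA IA, of 0] conj[OF fK, of 0] by simp
  then obtain d where d: "c = card ?I + d"
    using le_Suc_ex by blast
  \<comment> \<open>\<open>p * c = p * card ?I + p * d\<close>, and the first summand is at most
    \<open>c = card ?I + d\<close>.\<close>
  have "p * c \<le> card ?I + (p + 1) * d"
    using I d by (simp add: algebra_simps)
  then show ?thesis
    using le d by simp
qed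

end

section \<open>Existence of the minimal subgroup, and the theorem\<close>

context group
begin

lemma ex_minimal_outside_p_core:
  assumes fin: "finite (carrier G)" and p: "Factorial_Ring.prime p"
    and x: "x \<in> p_elements p G" "x \<notin> p_core p G"
  shows "\<exists>U K. minimal_outside_p_core G p U K \<and> K \<noteq> {} \<and> (\<forall>k \<in> K. \<exists>g \<in> carrier G. k = conjg g x)"
proof -
  have xc: "x \<in> carrier G"
    using x by (simp add: p_elements_def)
  define Cl where "Cl = {conjg g x |g. g \<in> carrier G}"
  let ?core = "\<lambda>V. p_core p (G\<lparr>carrier := V\<rparr>)"
  \<comment> \<open>\<open>P V\<close> says that some conjugate of \<open>x\<close> lies in
    \<open>V\<close> outside its \<open>p\<close>-core. The whole group satisfies it by the choice
    of \<open>x\<close>, so a \<open>U\<close> of least order exists.\<close>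
  define P where "P V \<longleftrightarrow> subgroup V G \<and> Cl \<inter> V - ?core V \<noteq> {}" for V
  have "conjg \<one> x \<in> Cl"
    unfolding Cl_def by blast
  then have "P (carrier G)"
    using xc x(2) subgroup_self by (auto simp: P_def)
  then obtain U where U: "P U" "\<And>V. P V \<Longrightarrow> card U \<le> card V"
    using ex_has_least_nat[of P "carrier G" card] by blast
  then have sU: "subgroup U G"
    by (simp add: P_def)
  define K where "K = Cl \<inter> U - ?core U"
  have Clc: "Cl \<subseteq> carrier G" "Cl \<subseteq> p_elements p G"
    using xc p_elements_conjg[OF _ x(1)] by (auto simp: Cl_def)
  have "minimal_outside_p_core G p U K"
  proof (rule minimal_outside_p_core.intro, rule is_group, rule minimal_outside_p_core_axioms.intro)
    show "finite (carrier G)" "Factorial_Ring.prime p" "subgroup U G" "K \<subseteq> U" "K \<subseteq> p_elements p G"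
      using fin p sU Clc by (auto simp: K_def)
    show "conjg u k \<in> K" if u: "u \<in> U" and k: "k \<in> K" for u k
    proof -
      have uc: "u \<in> carrier G" "k \<in> carrier G" "k \<in> U"
        using u k Clc subgroup.mem_carrier[OF sU] by (auto simp: K_def)
      obtain g where g: "g \<in> carrier G" "k = conjg g x"
        using k by (auto simp: K_def Cl_def)
      then have "conjg u k = conjg (u \<otimes> g) x"
        using uc xc by (simp add: conjg_mult)
      then have "conjg u k \<in> Cl"
        using uc g unfolding Cl_def by blast
      moreover have "conjg u k \<in> U"
        using u uc sU by (simp add: conjg_def subgroup.m_closed subgroup.m_inv_closed)
      \<comment> \<open>The \<open>p\<close>-core is invariant under \<open>inv u\<close>, which
        would bring \<open>k\<close> back into it.\<close>
      moreover have "conjg u k \<notin> ?core U"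
      proof
        assume "conjg u k \<in> ?core U"
        then have "conjg (inv u) (conjg u k) \<in> ?core U"
          using p_core_subgroup(3)[OF fin p sU] subgroup.m_inv_closed[OF sU u] by blast
        then show False
          using k uc by (simp add: K_def)
      qed
      ultimately show ?thesis
        by (simp add: K_def)
    qed
    show "\<exists>Q. p_subgroup p Q \<and> Q \<subseteq> V \<and> K \<inter> V \<subseteq> Q" if V: "subgroup V G" "V \<subset> U" for V
    proof -
      have "card V < card U"
        using V(2) fin finite_subset[OF subgroup.subset[OF sU]] by (intro psubset_card_mono) auto
      \<comment> \<open>By the least order of \<open>U\<close>; so every conjugate of
        \<open>x\<close> in \<open>V\<close>, in particular every member of \<open>K\<close>, lies
        in the \<open>p\<close>-core of \<open>V\<close>.\<close>
      then have "\<not> P V"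
        using U(2)[of V] by auto
      then have "K \<inter> V \<subseteq> ?core V"
        using V by (auto simp: P_def K_def)
      then show ?thesis
        using p_core_subgroup(1,2)[OF fin p V(1)] by blast
    qed
    show "Q \<inter> K = {}" if "p_subgroup p Q" "Q \<subseteq> U" "\<forall>u \<in> U. conjg u ` Q \<subseteq> Q" for Q
      using p_core_subgroup_greatest[OF fin p sU that] by (auto simp: K_def)
  qed
  moreover have "K \<noteq> {}"
    using U(1) by (simp add: K_def P_def)
  moreover have "\<forall>k \<in> K. \<exists>g \<in> carrier G. k = conjg g x"
    by (auto simp: K_def Cl_def)
  ultimately show ?thesis
    by blast
qed

end

theorem theoremC:
  fixes G :: "('a, 'b) monoid_scheme" and p :: nat and x :: 'a
  assumes "group G" and "finite (carrier G)" and "Factorial_Ring.prime p"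
    and "x \<in> p_elements p G" and "x \<notin> p_core p G"
  shows "real (card (p_elements p (centralizer_group G x))) / real (card (p_elements p G)) \<le> 1 / real p"
proof -
  interpret group G
    by fact
  have xc: "x \<in> carrier G"
    using assms(4) by (simp add: p_elements_def)
  obtain U K where UK: "minimal_outside_p_core G p U K" and ne: "K \<noteq> {}"
    and conj: "\<And>k. k \<in> K \<Longrightarrow> \<exists>g \<in> carrier G. k = conjg g x"
    using ex_minimal_outside_p_core[OF assms(2-5)] by blast
  interpret minimal_outside_p_core G p U K
    by (rule UK)
  have "p * card (p_centralizer p x) \<le> card (p_elements p G)"
  proof -
    obtain k where "k \<in> K"
      using ne by blast
    \<comment> \<open>Members of \<open>K\<close> are conjugate to \<open>x\<close>, which supplies
      the common size \<open>c\<close> in \<open>p_centralizer_bound\<close>.\<close>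
    moreover have "card (p_centralizer p l) = card (p_centralizer p x)" if "l \<in> K" for l
      using conj[OF that] p_centralizer_conjg[OF _ xc] by auto
    ultimately show ?thesis
      by (rule p_centralizer_bound)
  qed
  then have "real p * real (card (p_centralizer p x)) \<le> real (card (p_elements p G))"
    by (metis of_nat_le_iff of_nat_mult)
  moreover have "p_elements p (centralizer_group G x) = p_centralizer p x"
    using p_elements_centralizer[OF xc] by (simp add: p_centralizer_def)
  \<comment> \<open>\<open>x\<close> is a member; this allows clearing the denominator.\<close>
  moreover have "card (p_elements p G) > 0"
    using assms(2,4) by (auto simp: card_gt_0_iff p_elements_def)
  moreover have "p > 0"
    using assms(3) by (rule prime_gt_0_nat)
  ultimately show ?thesis
    by (simp add: field_simps)
qed

end
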